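(* Let $\theta(\mathbf{A},\mathbf{B}) = g(\mathbf{Y}(\mathbf{A}),\mathbf{Y}(\mathbf{B}))$ be any non-degenerate estimand (that is, the function $g$ is not constant), and let $\mathcal{R}$ be any assignment mechanism such that $\mathbb{P}_{\mathcal{R}}(\mathbf{Z}=\mathbf{A}) = \mathbb{P}_{\mathcal{R}}(\mathbf{Z}=\mathbf{B}) = 0$. Then, under arbitrary interference, there exists no unbiased estimator of $\theta(\mathbf{A},\mathbf{B})$ under $\mathcal{R}$.
   Context: There are $N$ units, each assigned to treatment $A$ or $B$. The assignment vector $\mathbf{Z}$ takes values in $\mathcal{Z}=\{A,B\}^N$; $\mathbf{A}=(A,\dots,A)$ and $\mathbf{B}=(B,\dots,B)$ are the assignments giving all units $A$, respectively all units $B$. For each $\mathbf{Z}\in\mathcal{Z}$ there is a fixed (non-random) vector of potential outcomes $\mathbf{Y}(\mathbf{Z})=(Y_1(\mathbf{Z}),\dots,Y_N(\mathbf{Z}))$. Potential outcomes are bounded: for a fixed constant $M>0$ (not depending on $N$), $0<Y_i(\mathbf{Z})<M$ for all $i$ and $\mathbf{Z}$. Arbitrary interference means that there is no other restriction: the family $\{\mathbf{Y}(\mathbf{Z})\}_{\mathbf{Z}\in\mathcal{Z}}$ may be any family of vectors in $(0,M)^N$, with no constraint relating $\mathbf{Y}(\mathbf{Z})$ and $\mathbf{Y}(\mathbf{Z}')$ for $\mathbf{Z}\neq\mathbf{Z}'$. An assignment mechanism (design) $\mathcal{R}$ is a probability distribution $\mathbb{P}_{\mathcal{R}}$ on $\mathcal{Z}$;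 it is the only source of randomness, and $\mathbb{E}_{\mathcal{R}}$ denotes expectation with respect to it. An estimand is a quantity $\theta(\mathbf{A},\mathbf{B})=g(\mathbf{Y}(\mathbf{A}),\mathbf{Y}(\mathbf{B}))$ with $g$ a real-valued function of the pair $(\mathbf{Y}(\mathbf{A}),\mathbf{Y}(\mathbf{B}))$. An estimator $\hat\theta(\mathbf{Z})$ is a real-valued function of the observed data, i.e. of the realized assignment $\mathbf{Z}$ and the observed outcome vector $\mathbf{Y}(\mathbf{Z})$ only. The estimator is unbiased under $\mathcal{R}$ if $\mathbb{E}_{\mathcal{R}}[\hat\theta(\mathbf{Z})]=\theta(\mathbf{A},\mathbf{B})$ for all values of the potential outcomes $\{\mathbf{Y}(\mathbf{Z})\}_{\mathbf{Z}\in\mathcal{Z}}$. *)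

theory Defs
  imports "HOL-Probability.Probability"
begin

datatype treatment = TrtA | TrtB

instance treatment :: finite
proof
  have "(UNIV :: treatment set) = {TrtA, TrtB}"
    using treatment.exhaust by auto
  then show "finite (UNIV :: treatment set)"
    by (metis finite.emptyI finite.insertI)
qed

text \<open>The units are the elements of a finite type \<open>'n\<close>, so that \<open>N = CARD('n)\<close>.\<close>

type_synonym 'n assignment = "'n \<Rightarrow> treatment"

definition all_A :: "'n assignment" where
  "all_A = (\<lambda>_. TrtA)"

definition all_B :: "'n assignment" where
  "all_B = (\<lambda>_. TrtB)"

definition outcome_vectors :: "real \<Rightarrow> (real ^ 'n) set" where
  "outcome_vectors M = {y. \<forall>i. 0 < y $ i \<and> y $ i < M}"

text \<open>Arbitrary interference: the outcome vectors under different assignments are unrelated.\<close>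

definition potential_outcomes :: "real \<Rightarrow> ('n assignment \<Rightarrow> real ^ 'n) set" where
  "potential_outcomes M = {Y. \<forall>Z. Y Z \<in> outcome_vectors M}"

definition estimand ::
    "((real ^ 'n) \<times> (real ^ 'n) \<Rightarrow> real) \<Rightarrow> ('n assignment \<Rightarrow> real ^ 'n) \<Rightarrow> real" where
  "estimand g Y = g (Y all_A, Y all_B)"

text \<open>An estimator sees only the realized assignment and the outcome vector observed under it.
  Since there are finitely many assignments, every estimator is integrable and the expectation
  below is a finite sum.\<close>

type_synonym 'n estimator = "'n assignment \<Rightarrow> real ^ 'n \<Rightarrow> real"

definition unbiased_estimator ::
    "real \<Rightarrow> ('n::finite) assignment pmf \<Rightarrow> ((real ^ 'n) \<times> (real ^ 'n) \<Rightarrow> real) \<Rightarrow> 'n estimator \<Rightarrow> bool"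
  where
  "unbiased_estimator M R g est \<longleftrightarrow>
     (\<forall>Y \<in> potential_outcomes M.
        measure_pmf.expectation R (\<lambda>Z. est Z (Y Z)) = estimand g Y)"

text \<open>The values of an estimand are those on admissible outcome vectors; what \<open>g\<close> does outside of
  these plays no role, so non-constancy is required on the admissible pairs.\<close>

definition nondegenerate_estimand ::
    "real \<Rightarrow> ((real ^ 'n) \<times> (real ^ 'n) \<Rightarrow> real) \<Rightarrow> bool" where
  "nondegenerate_estimand M g \<longleftrightarrow> \<not> g constant_on (outcome_vectors M \<times> outcome_vectors M)"

end

theory Submission
  imports Defs
begin

text \<open>The estimand depends only on the potential outcomes under \<open>all_A\<close> and \<open>all_B\<close>, which the design
  almost surely never reveals: changing just these two outcome vectors can change the estimand but
  not the expectation of an estimator.\<close>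

text \<open>Index types in HOL are nonempty, so some unit tells the two assignments apart.\<close>

lemma all_A_neq_all_B: "all_A \<noteq> all_B"
  by (simp add: all_A_def all_B_def fun_eq_iff)

text \<open>A point of probability zero lies outside the support of a pmf, so the two integrands
  agree on the whole support.\<close>

lemma expectation_cong_off_null:
  fixes R :: "'n::finite assignment pmf" and est :: "'n estimator"
  assumes "measure_pmf.prob R {all_A} = 0"
    and "measure_pmf.prob R {all_B} = 0"
    and "\<And>Z. Z \<noteq> all_A \<Longrightarrow> Z \<noteq> all_B \<Longrightarrow> Y Z = Y' Z"
  shows "measure_pmf.expectation R (\<lambda>Z. est Z (Y Z)) = measure_pmf.expectation R (\<lambda>Z. est Z (Y' Z))"
proof (rule integral_cong_AE)
  have "all_A \<notin> set_pmf R" "all_B \<notin> set_pmf R"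
    using assms(1,2) by (simp_all add: measure_pmf_single set_pmf_iff)
  then show "AE Z in measure_pmf R. est Z (Y Z) = est Z (Y' Z)"
    by (intro AE_pmfI) (metis assms(3))
qed simp_all

theorem theorem1:
  fixes M :: real
    and g :: "(real ^ 'n) \<times> (real ^ 'n) \<Rightarrow> real"
    and R :: "('n::finite) assignment pmf"
  assumes "M > 0"
    and "nondegenerate_estimand M g"
    and "measure_pmf.prob R {all_A} = 0"
    and "measure_pmf.prob R {all_B} = 0"
  shows "\<not> (\<exists>est :: 'n estimator. unbiased_estimator M R g est)"
proof
  assume "\<exists>est :: 'n estimator. unbiased_estimator M R g est"
  then obtain est :: "'n estimator" where est: "unbiased_estimator M R g est" ..
  \<comment> \<open>Every function is constant on the empty set, so non-constancy of
    \<open>g\<close> supplies an admissible pair.\<close>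
  obtain y :: "(real ^ 'n) \<times> (real ^ 'n)" where y: "y \<in> outcome_vectors M \<times> outcome_vectors M"
    using assms(2) unfolding nondegenerate_estimand_def constant_on_def by blast
  \<comment> \<open>Arbitrary interference admits this family for every admissible \<open>p\<close>.
    The filler \<open>fst y\<close> does not depend on \<open>p\<close>, so two such families differ
    at most at \<open>all_A\<close> and \<open>all_B\<close>.\<close>
  define Y :: "(real ^ 'n) \<times> (real ^ 'n) \<Rightarrow> 'n assignment \<Rightarrow> real ^ 'n" where
    "Y p = (\<lambda>_. fst y)(all_A := fst p, all_B := snd p)" for p
  have g_eq: "g p = measure_pmf.expectation R (\<lambda>Z. est Z (Y p Z))"
    if "p \<in> outcome_vectors M \<times> outcome_vectors M" for p
  proof -
    have "Y p \<in> potential_outcomes M"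
      using that y by (auto simp: potential_outcomes_def Y_def)
    moreover have "estimand g (Y p) = g p"
      by (simp add: estimand_def Y_def all_A_neq_all_B)
    ultimately show ?thesis
      using est by (simp add: unbiased_estimator_def)
  qed
  have "g p = g y" if "p \<in> outcome_vectors M \<times> outcome_vectors M" for p
    unfolding g_eq[OF that] g_eq[OF y]
    by (rule expectation_cong_off_null[OF assms(3,4)]) (simp add: Y_def)
  then have "g constant_on (outcome_vectors M \<times> outcome_vectors M)"
    unfolding constant_on_def by blast
  with assms(2) show False
    by (simp add: nondegenerate_estimand_def)
qed

end
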